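(* (Soundness) Let $\sigma=(S,M,V)$ be a signature with a modelable context structure $R$ on $V$, and let $\Delta=\Delta_R$ be the associated structure category. Let $E\cup\{\phi\}$ be an $R$-theory. If $E\vdash_R\phi$, then $E\vDash_C\phi$ for every $\Delta$-multicategory $C$.
   Context: **Finite ordinals and structure categories.** $[n]=\{1,\dots,n\}$ for $n\in\mathbb N$ ($0\in\mathbb N$); $\mathbf{FinOrd}$ is the category of the sets $[n]$ and all functions. For $f_i\colon[m_i]\to[n_i]$ ($i\le k$), $f_1+\dots+f_k\colon[M_k]\to[N_k]$ sends $M_{i-1}+x\mapsto N_{i-1}+f_i(x)$ for $0<x\le m_i$, where $M_i=\sum_{j\le i}m_j$, $N_i=\sum_{j\le i}n_j$. For $\theta\colon[m]\to[n]$ and $k_1,\dots,k_n\in\mathbb N$, the similarity component $\theta'_{k_1,\dots,k_n}\colon[k_{\theta(1)}+\dots+k_{\theta(m)}]\to[k_1+\dots+k_n]$ sends $L_{i-1}+x\mapsto K_{\theta(i)-1}+x$ for $0<x\le k_{\theta(i)}$, where $L_i=k_{\theta(1)}+\dots+k_{\theta(i)}$, $K_j=k_1+\dots+k_j$. A structure category is a wide subcategory $\Delta$ of $\mathbf{FinOrd}$ closed under coproducts of morphisms and such that $\theta\in\Delta$ implies that all $\theta'_{k_1,\dots,k_n}\in\Delta$. **$\Delta$-multicategories.** A $\Delta$-multicategory $C$ has a class of objects, sets $C(a,b)$ of multimorphisms $f\colon a\to b$ for each finite word $a$ of objects and object $b$, compositions $C(b_1\cdots b_n,c)\times C(a^1,b_1)\times\dots\times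 C(a^n,b_n)\to C(a^1\cdots a^n,c)$, $(g,f_1,\dots,f_n)\mapsto g\circ(f_1,\dots,f_n)$, identities $id_a\colon a\to a$, and for each $\theta\colon[m]\to[n]$ in $\Delta$ functions $\theta_{a_1\cdots a_n,b,*}\colon C(a_{\theta(1)}\cdots a_{\theta(m)},b)\to C(a_1\cdots a_n,b)$ (indices often dropped), such that composition is associative and unital (the usual multicategory axioms) and: (1) $(id_{[n]})_*=id$; (2) $(\tau\sigma)_{*}=\tau_{*}\circ\sigma_{*}$ for composable $\sigma,\tau$ in $\Delta$; (3) $g\circ(\sigma^1_*(f_1),\dots,\sigma^n_*(f_n))=(\sigma^1+\dots+\sigma^n)_*(g\circ(f_1,\dots,f_n))$ for $\sigma^i\colon[k_i]\to[l_i]$ in $\Delta$, $g\colon b_1\cdots b_n\to c$, $f_i\colon a^i_{\sigma^i(1)}\cdots a^i_{\sigma^i(k_i)}\to b_i$; (4) $\tau_*(g)\circ(f_1,\dots,f_n)=(\tau'_{k_1,\dots,k_n})_*(g\circ(f_{\tau(1)},\dots,f_{\tau(m)}))$ for $\tau\colon[m]\to[n]$ in $\Delta$, $f_i\colon a^i\to b_i$ with $a^i$ of length $k_i$, and $g\colon b_{\tau(1)}\cdots b_{\tau(m)}\to c$. **Context structures.** For a set $V$, a context is a word in $V^*$ with no repeated letter; $\mathcal C$ is the set of contexts; $\mathrm{Var}(v)$ is the set of letters of $v$. A context structure on $V$ is a relation $R\subset \mathcal C\times V^*$ with: (1) $cRc$ for all contexts $c$; (2) $cRv$ implies $\mathrm{Var}(v)\subset\mathrm{Var}(c)$;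 (3) $cRv^1\cdots v^n$ and $v^iRw^i$ for $i\le n$ imply $cRw^1\cdots w^n$; (4) if $cRv$, $s\colon\mathrm{Var}(c)\to V^*$ and $dRs(c)$, then $dRs(v)$, where $s(v_1\cdots v_n)=s(v_1)\cdots s(v_n)$. $R$ is modelable if $cRv^1\cdots v^n$ implies there are contexts $c^1,\dots,c^n$ with $cRc^1\cdots c^n$ and $c^iRv^i$. For $V$ infinite, $\Delta_R$ is the structure category of those $\theta\colon[m]\to[n]$ with $c_1\cdots c_nRc_{\theta(1)}\cdots c_{\theta(m)}$ for a context $c=c_1\cdots c_n$. **Syntax.** A signature $\sigma=(S,M,V)$ consists of a set $S$ of sorts, a set $M$ of function symbols $f\colon a\to b$ typed by $(a,b)\in S^*\times S$ (constants when $a=()$), and a set $V$ of typed variables $x\colon s$ with countably infinitely many of each sort. Terms are built as usual from variables, constants and function symbols, respecting types. $\tau(t)\in V^*$: $\tau(x)=x$, $\tau(c)=()$, $\tau(f(t_1,\dots,t_n))=\tau(t_1)\cdots\tau(t_n)$. A context $c$ is an $R$-context for $t$ if $cR\tau(t)$. An $R$-equation $t_1\approx_vt_2$ is a pair of terms of the same sort with a common $R$-context $v$; an $R$-theory is a set of $R$-equations. For a context $v=v_1\cdots v_n$, an $R$-renaming of $v$ is a triple $(s,w,(w_i)_{i\le n})$ where $s$ is a type-preserving map from $\mathrm{Var}(v)$ to terms (extended to terms with variables in $v$ by substitution), $w,w_i$ are contexts, $wRw_1\cdots w_n$ and $w_iR\tau(s(v_i))$ for all $i$. **Deduction.** For an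 $R$-theory $E$, $D^R_E$ is the smallest set $D$ of $R$-equations containing $E$, containing $t\approx_vt$ for every term $t$ with $R$-context $v$, closed under symmetry and transitivity (in a fixed context $v$), and such that if $t_1\approx_vt_2\in D$, $v=v_1\cdots v_n$, and $(s_1,w,(w_i)),(s_2,w,(w_i))$ are $R$-renamings of $v$ with $s_1(v_i)\approx_{w_i}s_2(v_i)\in D$ for all $i$, then $s_1(t_1)\approx_ws_2(t_2)\in D$. $E\vdash_R\phi$ means $\phi\in D^R_E$. **Models.** A $\sigma$-model $m$ in a multicategory $C$ assigns an object $m(s)$ to each sort and a multimorphism $m(f)\colon m(a_1)\cdots m(a_n)\to m(b)$ to each $f\colon a_1\cdots a_n\to b$. For $v=v_1\cdots v_n$ with $v_i\colon a_i$, put $m_v=m(a_1)\cdots m(a_n)$. If $C$ is a $\Delta_R$-multicategory, $v=v_1\cdots v_n$ is a context, $vRw$ and $w=v_{\theta(1)}\cdots v_{\theta(k)}$, then for $g\colon m_w\to b$ write $g*m_{v,w}=\theta_{m_v,b,*}(g)\colon m_v\to b$. For a term $t\colon b$ with $R$-context $v$, define $m_v(t)\colon m_v\to m(b)$ by $m_v(v_i)=id_{m(b)}*m_{v,v_i}$; $m_v(c)=m(c)*m_{v,()}$ for constants $c$; $m_v(f(t_1,\dots,t_k))=(m(f)\circ(m_{w_1}(t_1),\dots,m_{w_k}(t_k)))*m_{v,w_1\cdots w_k}$ for any contexts $w_i$ with $w_iR\tau(t_i)$ and $vRw_1\cdots w_k$. $m\vDash t_1\approx_vt_2$ means $m_v(t_1)=m_v(t_2)$;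 $m\vDash E$ means $m$ satisfies all equations of $E$. $E\vDash_C\phi$ means every $\sigma$-model $m$ in $C$ with $m\vDash E$ satisfies $m\vDash\phi$. *)

theory Defs
  imports Main "HOL-Library.Countable_Set"
begin

section \<open>Finite ordinals and structure categories\<close>

text \<open>
  The finite ordinal with \<open>n\<close> elements is taken to be \<open>{..<n}\<close> instead of \<open>{1, ..., n}\<close>, to
  agree with the indexing of lists.  A function from the \<open>m\<close>-element to the \<open>n\<close>-element ordinal is
  the list of its \<open>m\<close> values.
\<close>

definition finord :: "nat \<Rightarrow> nat \<Rightarrow> nat list set" where
  "finord m n = {\<theta>. length \<theta> = m \<and> set \<theta> \<subseteq> {..<n}}"

text \<open>
  For a word \<open>a\<close> of length \<open>n\<close>, \<open>reindex a \<theta>\<close> is the word with letters \<open>a ! (\<theta> ! i)\<close>.  Since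
  functions are the words of their values, \<open>reindex \<tau> \<sigma>\<close> is also the composite of \<open>\<sigma>\<close> followed
  by \<open>\<tau>\<close>.
\<close>

definition reindex :: "'a list \<Rightarrow> nat list \<Rightarrow> 'a list" where
  "reindex a \<theta> = map (\<lambda>j. a ! j) \<theta>"

text \<open>The coproduct of the functions \<open>\<sigma>s ! i\<close>, where \<open>ns ! i\<close> is the codomain of \<open>\<sigma>s ! i\<close>.\<close>

definition coprod :: "nat list list \<Rightarrow> nat list \<Rightarrow> nat list" where
  "coprod \<sigma>s ns =
     concat (map (\<lambda>i. map (\<lambda>y. sum_list (take i ns) + y) (\<sigma>s ! i)) [0..<length \<sigma>s])"

definition similarity :: "nat list \<Rightarrow> nat list \<Rightarrow> nat list" where
  "similarity \<theta> ks = concat (map (\<lambda>j. map (\<lambda>x. sum_list (take j ks) + x) [0..<ks ! j]) \<theta>)"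

locale structure_category =
  fixes \<Delta> :: "nat \<Rightarrow> nat \<Rightarrow> nat list set"
  assumes hom_finord: "\<Delta> m n \<subseteq> finord m n"
    and id_closed: "[0..<n] \<in> \<Delta> n n"
    and comp_closed: "\<sigma> \<in> \<Delta> k m \<Longrightarrow> \<tau> \<in> \<Delta> m n \<Longrightarrow> reindex \<tau> \<sigma> \<in> \<Delta> k n"
    and coprod_closed:
      "length ms = length \<sigma>s \<Longrightarrow> length ns = length \<sigma>s \<Longrightarrow>
       (\<And>i. i < length \<sigma>s \<Longrightarrow> \<sigma>s ! i \<in> \<Delta> (ms ! i) (ns ! i)) \<Longrightarrow>
       coprod \<sigma>s ns \<in> \<Delta> (sum_list ms) (sum_list ns)"
    and similarity_closed:
      "\<theta> \<in> \<Delta> m n \<Longrightarrow> length ks = n \<Longrightarrow>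
       similarity \<theta> ks \<in> \<Delta> (sum_list (reindex ks \<theta>)) (sum_list ks)"


section \<open>Multicategories over a structure category\<close>

text \<open>
  The sets \<open>Hom C a b\<close> need not be disjoint for different \<open>a\<close>, \<open>b\<close>; therefore all operations carry
  the objects involved as arguments.  \<open>Comp C as bs c\<close> is the composition whose first argument lies
  in \<open>Hom C bs c\<close> and whose further arguments lie in \<open>Hom C (as ! i) (bs ! i)\<close>, and \<open>Act C \<theta> a b\<close>
  maps \<open>Hom C (reindex a \<theta>) b\<close> to \<open>Hom C a b\<close>.
\<close>

record ('o, 'm) multicat =
  Ob :: "'o set"
  Hom :: "'o list \<Rightarrow> 'o \<Rightarrow> 'm set"
  Comp :: "'o list list \<Rightarrow> 'o list \<Rightarrow> 'o \<Rightarrow> 'm \<Rightarrow> 'm list \<Rightarrow> 'm"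
  Ident :: "'o \<Rightarrow> 'm"
  Act :: "nat list \<Rightarrow> 'o list \<Rightarrow> 'o \<Rightarrow> 'm \<Rightarrow> 'm"

definition Homs :: "('o, 'm) multicat \<Rightarrow> 'o list list \<Rightarrow> 'o list \<Rightarrow> 'm list set" where
  "Homs C as bs = {fs. as \<in> lists (lists (Ob C)) \<and> bs \<in> lists (Ob C) \<and>
     length as = length bs \<and> length fs = length bs \<and>
     (\<forall>i<length bs. fs ! i \<in> Hom C (as ! i) (bs ! i))}"

locale Delta_multicategory = structure_category \<Delta>
  for \<Delta> :: "nat \<Rightarrow> nat \<Rightarrow> nat list set" +
  fixes C :: "('o, 'm) multicat"
  assumes Comp_in_Hom:
      "c \<in> Ob C \<Longrightarrow> g \<in> Hom C bs c \<Longrightarrow> fs \<in> Homs C as bs \<Longrightarrow>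
       Comp C as bs c g fs \<in> Hom C (concat as) c"
    and Ident_in_Hom: "b \<in> Ob C \<Longrightarrow> Ident C b \<in> Hom C [b] b"
    and Act_in_Hom:
      "\<theta> \<in> \<Delta> m n \<Longrightarrow> a \<in> lists (Ob C) \<Longrightarrow> length a = n \<Longrightarrow> b \<in> Ob C \<Longrightarrow>
       f \<in> Hom C (reindex a \<theta>) b \<Longrightarrow> Act C \<theta> a b f \<in> Hom C a b"
    and Comp_assoc:
      "d \<in> Ob C \<Longrightarrow> g \<in> Hom C cs d \<Longrightarrow> fs \<in> Homs C bss cs \<Longrightarrow>
       length ass = length cs \<Longrightarrow> length hss = length cs \<Longrightarrow>
       (\<And>i. i < length cs \<Longrightarrow> hss ! i \<in> Homs C (ass ! i) (bss ! i)) \<Longrightarrow>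
       Comp C (map concat ass) cs d g
         (map (\<lambda>i. Comp C (ass ! i) (bss ! i) (cs ! i) (fs ! i) (hss ! i)) [0..<length cs])
       = Comp C (concat ass) (concat bss) d (Comp C bss cs d g fs) (concat hss)"
    and Comp_Ident_left:
      "a \<in> lists (Ob C) \<Longrightarrow> b \<in> Ob C \<Longrightarrow> f \<in> Hom C a b \<Longrightarrow> Comp C [a] [b] b (Ident C b) [f] = f"
    and Comp_Ident_right:
      "a \<in> lists (Ob C) \<Longrightarrow> b \<in> Ob C \<Longrightarrow> f \<in> Hom C a b \<Longrightarrow>
       Comp C (map (\<lambda>x. [x]) a) a b f (map (Ident C) a) = f"
    and Act_id:
      "a \<in> lists (Ob C) \<Longrightarrow> b \<in> Ob C \<Longrightarrow> f \<in> Hom C a b \<Longrightarrow> Act C [0..<length a] a b f = f"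
    and Act_comp:
      "\<sigma> \<in> \<Delta> k m \<Longrightarrow> \<tau> \<in> \<Delta> m n \<Longrightarrow> a \<in> lists (Ob C) \<Longrightarrow> length a = n \<Longrightarrow> b \<in> Ob C \<Longrightarrow>
       f \<in> Hom C (reindex a (reindex \<tau> \<sigma>)) b \<Longrightarrow>
       Act C (reindex \<tau> \<sigma>) a b f = Act C \<tau> a b (Act C \<sigma> (reindex a \<tau>) b f)"
    and Comp_Act_args:
      "c \<in> Ob C \<Longrightarrow> g \<in> Hom C bs c \<Longrightarrow> as \<in> lists (lists (Ob C)) \<Longrightarrow>
       length as = length bs \<Longrightarrow> length \<sigma>s = length bs \<Longrightarrow> length ks = length bs \<Longrightarrow>
       (\<And>i. i < length bs \<Longrightarrow> \<sigma>s ! i \<in> \<Delta> (ks ! i) (length (as ! i))) \<Longrightarrow>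
       fs \<in> Homs C (map2 reindex as \<sigma>s) bs \<Longrightarrow>
       Comp C as bs c g (map (\<lambda>i. Act C (\<sigma>s ! i) (as ! i) (bs ! i) (fs ! i)) [0..<length bs])
       = Act C (coprod \<sigma>s (map length as)) (concat as) c (Comp C (map2 reindex as \<sigma>s) bs c g fs)"
    and Comp_Act_fun:
      "\<tau> \<in> \<Delta> m n \<Longrightarrow> c \<in> Ob C \<Longrightarrow> length bs = n \<Longrightarrow> fs \<in> Homs C as bs \<Longrightarrow>
       g \<in> Hom C (reindex bs \<tau>) c \<Longrightarrow>
       Comp C as bs c (Act C \<tau> bs c g) fs
       = Act C (similarity \<tau> (map length as)) (concat as) c
           (Comp C (reindex as \<tau>) (reindex bs \<tau>) c g (reindex fs \<tau>))"


section \<open>Context structures\<close>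

definition is_context :: "'v set \<Rightarrow> 'v list \<Rightarrow> bool" where
  "is_context V c \<longleftrightarrow> c \<in> lists V \<and> distinct c"

locale context_structure =
  fixes V :: "'v set" and R :: "'v list \<Rightarrow> 'v list \<Rightarrow> bool"
  assumes R_dom: "R c v \<Longrightarrow> is_context V c \<and> v \<in> lists V"
    and R_refl: "is_context V c \<Longrightarrow> R c c"
    and R_vars: "R c v \<Longrightarrow> set v \<subseteq> set c"
    and R_concat: "R c (concat vs) \<Longrightarrow> list_all2 R vs ws \<Longrightarrow> R c (concat ws)"
    and R_subst:
      "R c v \<Longrightarrow> (\<And>x. x \<in> set c \<Longrightarrow> s x \<in> lists V) \<Longrightarrow> R d (concat (map s c)) \<Longrightarrow>
       R d (concat (map s v))"

definition modelable :: "('v list \<Rightarrow> 'v list \<Rightarrow> bool) \<Rightarrow> bool" where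
  "modelable R \<longleftrightarrow> (\<forall>c vs. R c (concat vs) \<longrightarrow> (\<exists>cs. R c (concat cs) \<and> list_all2 R cs vs))"

definition Delta :: "'v set \<Rightarrow> ('v list \<Rightarrow> 'v list \<Rightarrow> bool) \<Rightarrow> nat \<Rightarrow> nat \<Rightarrow> nat list set" where
  "Delta V R m n =
     {\<theta> \<in> finord m n. \<exists>c. is_context V c \<and> length c = n \<and> R c (reindex c \<theta>)}"


lemma (in context_structure) R_block:
  assumes "R c (reindex c \<theta>)" "set \<theta> \<subseteq> {..<length c}" "length ws = length c"
    and d: "R d (concat ws)"
  shows "R d (concat (reindex ws \<theta>))"
proof -
  have c: "is_context V c" using R_dom assms(1) by blast
  define s where "s x = ws ! (THE i. i < length c \<and> c ! i = x)" for x
  have s: "s (c ! i) = ws ! i" if "i < length c" for i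
  proof -
    have "(THE j. j < length c \<and> c ! j = c ! i) = i"
      using c that by (intro the_equality) (auto simp: is_context_def nth_eq_iff_index_eq)
    then show ?thesis by (simp add: s_def)
  qed
  have "map s c = ws" using assms(3) s by (intro nth_equalityI) auto
  moreover have "map s (reindex c \<theta>) = reindex ws \<theta>"
    using assms(2) s by (auto simp: reindex_def)
  moreover have "s x \<in> lists V" if "x \<in> set c" for x
    using that R_dom[OF d] s assms(3) by (fastforce simp: in_set_conv_nth)
  ultimately show ?thesis
    using R_subst[OF assms(1), of s d] d by simp
qed

lemma concat_singletons: "concat (map (\<lambda>x. [x]) xs) = xs"
  by (induction xs) auto

lemma reindex_singletons: "set \<theta> \<subseteq> {..<length c} \<Longrightarrow>
    reindex (map (\<lambda>x. [x]) c) \<theta> = map (\<lambda>x. [x]) (reindex c \<theta>)"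
  by (auto simp: reindex_def)

lemma (in context_structure) Delta_R:
  assumes "\<theta> \<in> Delta V R m n" "is_context V c" "length c = n"
  shows "R c (reindex c \<theta>)"
proof -
  obtain c' where c': "length c' = n" "R c' (reindex c' \<theta>)" "set \<theta> \<subseteq> {..<n}"
    using assms(1) by (auto simp: Delta_def finord_def)
  have "R (concat (map (\<lambda>x. [x]) c)) (concat (reindex (map (\<lambda>x. [x]) c) \<theta>))"
    using c' assms by (intro R_block[of c']) (auto simp: concat_singletons intro: R_refl)
  then show ?thesis using c' assms by (simp add: concat_singletons reindex_singletons)
qed

lemma split_word:
  assumes "length c = sum_list ks"
  obtains cs where "concat cs = c" "map length cs = ks"
  using assms
proof (induction ks arbitrary: c thesis)
  case (Cons k ks)
  obtain cs where "concat cs = drop k c" "map length cs = ks"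
    using Cons.IH[of "drop k c"] Cons.prems(2) by auto
  then show ?case using Cons.prems by (intro Cons.prems(1)[of "take k c # cs"]) auto
qed simp

lemma nth_concat_take:
  "i < length cs \<Longrightarrow> x < length (cs ! i) \<Longrightarrow>
    concat cs ! (sum_list (take i (map length cs)) + x) = cs ! i ! x"
proof (induction cs arbitrary: i)
  case (Cons d cs)
  then show ?case by (cases i) (auto simp: nth_append)
qed simp

lemma concat_length_le:
  fixes ns :: "nat list"
  shows "i < length ns \<Longrightarrow> sum_list (take i ns) + ns ! i \<le> sum_list ns"
proof (induction ns arbitrary: i)
  case (Cons d cs)
  then show ?case by (cases i) auto
qed simp

lemma reindex_coprod:
  assumes "length \<sigma>s = length cs" "\<And>i. i < length cs \<Longrightarrow> set (\<sigma>s ! i) \<subseteq> {..<length (cs ! i)}"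
  shows "reindex (concat cs) (coprod \<sigma>s (map length cs)) = concat (map2 reindex cs \<sigma>s)"
proof -
  have "map2 reindex cs \<sigma>s = map (\<lambda>i. reindex (cs ! i) (\<sigma>s ! i)) [0..<length \<sigma>s]"
    using assms(1) by (intro nth_equalityI) auto
  then show ?thesis
    using assms unfolding coprod_def reindex_def map_concat map_map
    by (intro arg_cong[where f = concat]) (fastforce simp: o_def intro!: nth_concat_take)
qed

lemma reindex_similarity:
  assumes "set \<theta> \<subseteq> {..<length cs}"
  shows "reindex (concat cs) (similarity \<theta> (map length cs)) = concat (reindex cs \<theta>)"
  using assms unfolding similarity_def reindex_def map_concat map_map
  by (intro arg_cong[where f = concat])
    (auto simp: o_def nth_concat_take intro!: nth_equalityI)

text \<open>
  Over an infinite \<open>V\<close> the assumption \<open>structure_category (Delta V R)\<close>, which is part of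
  \<open>Delta_multicategory (Delta V R) C\<close>, always holds.
\<close>

lemma (in context_structure) structure_category_Delta:
  assumes "infinite V"
  shows "structure_category (Delta V R)"
proof
  have ex: "\<exists>c. is_context V c \<and> length c = n" for n
  proof -
    obtain A where "A \<subseteq> V" "finite A" "card A = n"
      using infinite_arbitrarily_large[OF assms] by blast
    then show ?thesis
      by (metis distinct_card finite_distinct_list in_lists_conv_set is_context_def subsetD)
  qed
  have DeltaD: "set \<theta> \<subseteq> {..<n}" "length \<theta> = m" if "\<theta> \<in> Delta V R m n" for \<theta> m n
    using that by (auto simp: Delta_def finord_def)
  show "Delta V R m n \<subseteq> finord m n" for m n by (auto simp: Delta_def)
  show "[0..<n] \<in> Delta V R n n" for n
  proof -
    obtain c where c: "is_context V c" "length c = n" using ex by blast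
    then have "reindex c [0..<n] = c" by (auto simp: reindex_def map_nth)
    then have "R c (reindex c [0..<n])" using c R_refl by simp
    then show ?thesis using c by (auto simp: Delta_def finord_def)
  qed
  show "reindex \<tau> \<sigma> \<in> Delta V R k n" if \<sigma>: "\<sigma> \<in> Delta V R k m" and \<tau>: "\<tau> \<in> Delta V R m n" for \<sigma> \<tau> k m n
  proof -
    obtain c where c: "is_context V c" "length c = n" using ex by blast
    have \<sigma>': "set \<sigma> \<subseteq> {..<length \<tau>}" using DeltaD[OF \<sigma>] DeltaD[OF \<tau>] by simp
    obtain d where d: "is_context V d" "length d = m" "R d (reindex d \<sigma>)"
      using \<sigma> by (auto simp: Delta_def)
    have "length (reindex c \<tau>) = m" using DeltaD[OF \<tau>] by (simp add: reindex_def)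
    then have "R c (reindex (reindex c \<tau>) \<sigma>)"
      using R_block[OF d(3), of "map (\<lambda>x. [x]) (reindex c \<tau>)" c] Delta_R[OF \<tau> c] DeltaD[OF \<sigma>] d
      by (simp add: concat_singletons reindex_singletons)
    moreover have "reindex (reindex c \<tau>) \<sigma> = reindex c (reindex \<tau> \<sigma>)"
      using \<sigma>' by (auto simp: reindex_def)
    ultimately have "R c (reindex c (reindex \<tau> \<sigma>))" by simp
    moreover have "reindex \<tau> \<sigma> \<in> finord k n"
      using DeltaD[OF \<sigma>] DeltaD[OF \<tau>] \<sigma>' by (fastforce simp: finord_def reindex_def dest: nth_mem)
    ultimately show ?thesis using c by (auto simp: Delta_def)
  qed
  show "coprod \<sigma>s ns \<in> Delta V R (sum_list ms) (sum_list ns)"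
    if len: "length ms = length \<sigma>s" "length ns = length \<sigma>s"
      and \<sigma>s: "\<And>i. i < length \<sigma>s \<Longrightarrow> \<sigma>s ! i \<in> Delta V R (ms ! i) (ns ! i)" for ms ns \<sigma>s
  proof -
    obtain c where c: "is_context V c" "length c = sum_list ns" using ex by blast
    then obtain cs where cs: "concat cs = c" "map length cs = ns" using split_word by metis
    have l: "length cs = length \<sigma>s" using cs len by (metis length_map)
    have D: "\<sigma>s ! i \<in> Delta V R (ms ! i) (length (cs ! i))" if "i < length cs" for i
      using \<sigma>s[of i] that l cs by (metis nth_map)
    have ctx: "is_context V (cs ! i)" if "i < length cs" for i
      using c cs that by (auto simp: is_context_def distinct_concat_iff)
    have "R c (concat cs)" using c cs R_refl by simp
    moreover have "list_all2 R cs (map2 reindex cs \<sigma>s)"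
      using l D ctx by (auto simp: list_all2_conv_all_nth intro: Delta_R)
    ultimately have "R c (concat (map2 reindex cs \<sigma>s))" by (rule R_concat)
    moreover have "reindex c (coprod \<sigma>s ns) = concat (map2 reindex cs \<sigma>s)"
      using reindex_coprod[of \<sigma>s cs] DeltaD[OF D] l cs by simp
    moreover have "length (coprod \<sigma>s ns) = sum_list ms"
    proof -
      have "map (\<lambda>i. length (\<sigma>s ! i)) [0..<length \<sigma>s] = ms"
        using len DeltaD[OF \<sigma>s] by (intro nth_equalityI) auto
      then show ?thesis by (simp add: coprod_def length_concat o_def)
    qed
    moreover have "set (coprod \<sigma>s ns) \<subseteq> {..<sum_list ns}"
    proof
      fix t assume "t \<in> set (coprod \<sigma>s ns)"
      then obtain i y where "i < length \<sigma>s" "y \<in> set (\<sigma>s ! i)" "t = sum_list (take i ns) + y"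
        by (auto simp: coprod_def)
      moreover from this have "y < ns ! i" using DeltaD(1)[OF \<sigma>s] by auto
      ultimately show "t \<in> {..<sum_list ns}" using concat_length_le[of i ns] len by simp
    qed
    ultimately show ?thesis using c by (auto simp: Delta_def finord_def)
  qed
  show "similarity \<theta> ks \<in> Delta V R (sum_list (reindex ks \<theta>)) (sum_list ks)"
    if \<theta>: "\<theta> \<in> Delta V R m n" and ks: "length ks = n" for \<theta> m n ks
  proof -
    obtain c where c: "is_context V c" "length c = sum_list ks" using ex by blast
    then obtain cs where cs: "concat cs = c" "map length cs = ks" using split_word by metis
    have l: "length cs = n" using cs ks by (metis length_map)
    obtain d where d: "length d = n" "R d (reindex d \<theta>)" using \<theta> by (auto simp: Delta_def)
    have "R c (concat (reindex cs \<theta>))"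
      using R_block[OF d(2)] DeltaD[OF \<theta>] d l c cs R_refl by simp
    then have "R c (reindex c (similarity \<theta> ks))"
      using reindex_similarity[of \<theta> cs] DeltaD[OF \<theta>] l cs by simp
    moreover have "length (similarity \<theta> ks) = sum_list (reindex ks \<theta>)"
      by (simp add: similarity_def length_concat o_def reindex_def)
    moreover have "set (similarity \<theta> ks) \<subseteq> {..<sum_list ks}"
    proof
      fix t assume "t \<in> set (similarity \<theta> ks)"
      then obtain j where "j \<in> set \<theta>" "t < ks ! j + sum_list (take j ks)"
        by (auto simp: similarity_def)
      moreover from this have "j < length ks" using DeltaD(1)[OF \<theta>] ks by auto
      ultimately show "t \<in> {..<sum_list ks}" using concat_length_le[of j ks] by simp
    qed
    ultimately show ?thesis using c by (auto simp: Delta_def finord_def)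
  qed
qed


section \<open>Syntax\<close>

record ('s, 'f, 'v) signature =
  Sorts :: "'s set"
  Syms :: "'f set"
  Vars :: "'v set"
  ftype :: "'f \<Rightarrow> 's list \<times> 's"
  vtype :: "'v \<Rightarrow> 's"

definition is_signature :: "('s, 'f, 'v) signature \<Rightarrow> bool" where
  "is_signature \<Sigma> \<longleftrightarrow>
     (\<forall>f\<in>Syms \<Sigma>. fst (ftype \<Sigma> f) \<in> lists (Sorts \<Sigma>) \<and> snd (ftype \<Sigma> f) \<in> Sorts \<Sigma>) \<and>
     (\<forall>x\<in>Vars \<Sigma>. vtype \<Sigma> x \<in> Sorts \<Sigma>) \<and>
     (\<forall>s\<in>Sorts \<Sigma>. infinite {x \<in> Vars \<Sigma>. vtype \<Sigma> x = s} \<and>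
                  countable {x \<in> Vars \<Sigma>. vtype \<Sigma> x = s})"

datatype ('f, 'v) trm = Var 'v | Fun 'f "('f, 'v) trm list"

inductive has_sort :: "('s, 'f, 'v) signature \<Rightarrow> ('f, 'v) trm \<Rightarrow> 's \<Rightarrow> bool"
  for \<Sigma> :: "('s, 'f, 'v) signature" where
  "x \<in> Vars \<Sigma> \<Longrightarrow> has_sort \<Sigma> (Var x) (vtype \<Sigma> x)"
| "f \<in> Syms \<Sigma> \<Longrightarrow> ftype \<Sigma> f = (ss, s) \<Longrightarrow> list_all2 (has_sort \<Sigma>) ts ss \<Longrightarrow>
   has_sort \<Sigma> (Fun f ts) s"

primrec tau :: "('f, 'v) trm \<Rightarrow> 'v list" where
  "tau (Var x) = [x]"
| "tau (Fun f ts) = concat (map tau ts)"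

primrec subst :: "('v \<Rightarrow> ('f, 'v) trm) \<Rightarrow> ('f, 'v) trm \<Rightarrow> ('f, 'v) trm" where
  "subst s (Var x) = s x"
| "subst s (Fun f ts) = Fun f (map (subst s) ts)"

datatype ('f, 'v) equation = Eq (ctxt: "'v list") (lhs: "('f, 'v) trm") (rhs: "('f, 'v) trm")
  (\<open>_ \<turnstile>/ _ \<approx> _\<close> [51, 51, 51] 50)

definition R_equations ::
  "('s, 'f, 'v) signature \<Rightarrow> ('v list \<Rightarrow> 'v list \<Rightarrow> bool) \<Rightarrow> ('f, 'v) equation set" where
  "R_equations \<Sigma> R =
     {v \<turnstile> t\<^sub>1 \<approx> t\<^sub>2 | v t\<^sub>1 t\<^sub>2.
        (\<exists>s. has_sort \<Sigma> t\<^sub>1 s \<and> has_sort \<Sigma> t\<^sub>2 s) \<and> R v (tau t\<^sub>1) \<and> R v (tau t\<^sub>2)}"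

definition R_theory ::
  "('s, 'f, 'v) signature \<Rightarrow> ('v list \<Rightarrow> 'v list \<Rightarrow> bool) \<Rightarrow> ('f, 'v) equation set \<Rightarrow> bool" where
  "R_theory \<Sigma> R E \<longleftrightarrow> E \<subseteq> R_equations \<Sigma> R"

definition R_renaming ::
  "('s, 'f, 'v) signature \<Rightarrow> ('v list \<Rightarrow> 'v list \<Rightarrow> bool) \<Rightarrow> 'v list \<Rightarrow>
   ('v \<Rightarrow> ('f, 'v) trm) \<Rightarrow> 'v list \<Rightarrow> 'v list list \<Rightarrow> bool" where
  "R_renaming \<Sigma> R v s w ws \<longleftrightarrow>
     (\<forall>x\<in>set v. has_sort \<Sigma> (s x) (vtype \<Sigma> x)) \<and>
     is_context (Vars \<Sigma>) w \<and> (\<forall>u\<in>set ws. is_context (Vars \<Sigma>) u) \<and>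
     length ws = length v \<and> R w (concat ws) \<and>
     (\<forall>i<length v. R (ws ! i) (tau (s (v ! i))))"


section \<open>Deduction\<close>

inductive_set deduct ::
  "('s, 'f, 'v) signature \<Rightarrow> ('v list \<Rightarrow> 'v list \<Rightarrow> bool) \<Rightarrow> ('f, 'v) equation set \<Rightarrow>
   ('f, 'v) equation set"
  for \<Sigma> :: "('s, 'f, 'v) signature" and R and E where
  ax: "e \<in> E \<Longrightarrow> e \<in> deduct \<Sigma> R E"
| refl: "has_sort \<Sigma> t s \<Longrightarrow> R v (tau t) \<Longrightarrow> (v \<turnstile> t \<approx> t) \<in> deduct \<Sigma> R E"
| sym: "(v \<turnstile> t\<^sub>1 \<approx> t\<^sub>2) \<in> deduct \<Sigma> R E \<Longrightarrow> (v \<turnstile> t\<^sub>2 \<approx> t\<^sub>1) \<in> deduct \<Sigma> R E"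
| trans: "(v \<turnstile> t\<^sub>1 \<approx> t\<^sub>2) \<in> deduct \<Sigma> R E \<Longrightarrow> (v \<turnstile> t\<^sub>2 \<approx> t\<^sub>3) \<in> deduct \<Sigma> R E \<Longrightarrow>
    (v \<turnstile> t\<^sub>1 \<approx> t\<^sub>3) \<in> deduct \<Sigma> R E"
| rename: "(v \<turnstile> t\<^sub>1 \<approx> t\<^sub>2) \<in> deduct \<Sigma> R E \<Longrightarrow>
    R_renaming \<Sigma> R v s\<^sub>1 w ws \<Longrightarrow> R_renaming \<Sigma> R v s\<^sub>2 w ws \<Longrightarrow>
    (\<And>i. i < length v \<Longrightarrow> (ws ! i \<turnstile> s\<^sub>1 (v ! i) \<approx> s\<^sub>2 (v ! i)) \<in> deduct \<Sigma> R E) \<Longrightarrow>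
    (w \<turnstile> subst s\<^sub>1 t\<^sub>1 \<approx> subst s\<^sub>2 t\<^sub>2) \<in> deduct \<Sigma> R E"

lemma tau_subst: "tau (subst s t) = concat (map (\<lambda>x. tau (s x)) (tau t))"
proof (induction t)
  case (Fun f ts)
  have "concat (map tau (map (subst s) us)) = concat (map (\<lambda>x. tau (s x)) (concat (map tau us)))"
    if "set us \<subseteq> set ts" for us
    using that Fun.IH by (induction us) auto
  from this[of ts] show ?case by simp
qed simp

lemma has_sort_subst:
  assumes "has_sort \<Sigma> t a" "\<And>x. x \<in> set (tau t) \<Longrightarrow> has_sort \<Sigma> (s x) (vtype \<Sigma> x)"
  shows "has_sort \<Sigma> (subst s t) a"
  using assms
proof (induction rule: has_sort.induct)
  case (2 f ss a ts)
  then have "list_all2 (has_sort \<Sigma>) (map (subst s) ts) ss"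
    by (fastforce simp: list_all2_conv_all_nth)
  then show ?case using 2 by (auto intro: has_sort.intros)
qed auto

lemma (in context_structure) R_renaming_tau:
  assumes "V = Vars \<Sigma>" "R_renaming \<Sigma> R v s w ws" "R v (tau t)"
  shows "R w (tau (subst s t))"
proof -
  have "list_all2 R ws (map (\<lambda>x. tau (s x)) v)" "R w (concat ws)"
    using assms(2) by (auto simp: R_renaming_def list_all2_conv_all_nth)
  then have w: "R w (concat (map (\<lambda>x. tau (s x)) v))" by (rule R_concat[rotated])
  have "tau (s x) \<in> lists V" if "x \<in> set v" for x
    using R_dom[OF w] that by auto
  from R_subst[OF assms(3) this w] show ?thesis by (simp add: tau_subst)
qed

text \<open>Closing under the rules stays inside the set of \<open>R\<close>-equations.\<close>

lemma deduct_R_equations: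
  assumes "context_structure (Vars \<Sigma>) R" "R_theory \<Sigma> R E" "e \<in> deduct \<Sigma> R E"
  shows "e \<in> R_equations \<Sigma> R"
proof -
  interpret context_structure "Vars \<Sigma>" R by fact
  have uniq: "has_sort \<Sigma> t a \<Longrightarrow> has_sort \<Sigma> t b \<Longrightarrow> a = b" for t a b
    by (auto elim!: has_sort.cases)
  show ?thesis
    using assms(3)
  proof (induction rule: deduct.induct)
    case (ax e)
    then show ?case using assms(2) by (auto simp: R_theory_def)
  next
    case (rename v t\<^sub>1 t\<^sub>2 s\<^sub>1 w ws s\<^sub>2)
    then obtain a where a: "has_sort \<Sigma> t\<^sub>1 a" "has_sort \<Sigma> t\<^sub>2 a" "R v (tau t\<^sub>1)" "R v (tau t\<^sub>2)"
      by (auto simp: R_equations_def)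
    have "has_sort \<Sigma> (subst s t) a"
      if "R_renaming \<Sigma> R v s w ws" "has_sort \<Sigma> t a" "R v (tau t)" for s t
      using that R_vars[OF that(3)] by (intro has_sort_subst) (auto simp: R_renaming_def)
    then show ?case
      using a rename(2,3) R_renaming_tau[OF HOL.refl] unfolding R_equations_def by blast
  qed (auto simp: R_equations_def dest: uniq)
qed


section \<open>Models\<close>

record ('s, 'f, 'o, 'm) model =
  obj :: "'s \<Rightarrow> 'o"
  mor :: "'f \<Rightarrow> 'm"

definition is_model ::
  "('s, 'f, 'v) signature \<Rightarrow> ('o, 'm) multicat \<Rightarrow> ('s, 'f, 'o, 'm) model \<Rightarrow> bool" where
  "is_model \<Sigma> C M \<longleftrightarrow>
     (\<forall>s\<in>Sorts \<Sigma>. obj M s \<in> Ob C) \<and>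
     (\<forall>f\<in>Syms \<Sigma>. mor M f \<in> Hom C (map (obj M) (fst (ftype \<Sigma> f))) (obj M (snd (ftype \<Sigma> f))))"

definition ctx_obj ::
  "('s, 'f, 'v) signature \<Rightarrow> ('s, 'f, 'o, 'm) model \<Rightarrow> 'v list \<Rightarrow> 'o list" where
  "ctx_obj \<Sigma> M v = map (\<lambda>x. obj M (vtype \<Sigma> x)) v"

text \<open>The function \<open>\<theta>\<close> with \<open>w = reindex v \<theta>\<close>, unique because \<open>v\<close> is a context.\<close>

definition index_fun :: "'v list \<Rightarrow> 'v list \<Rightarrow> nat list" where
  "index_fun v w = (THE \<theta>. \<theta> \<in> finord (length w) (length v) \<and> reindex v \<theta> = w)"

text \<open>\<open>weaken \<Sigma> C M v w b g\<close> is written \<open>g * m\<^bsub>v,w\<^esub>\<close> in the literature.\<close>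

definition weaken ::
  "('s, 'f, 'v) signature \<Rightarrow> ('o, 'm) multicat \<Rightarrow> ('s, 'f, 'o, 'm) model \<Rightarrow>
   'v list \<Rightarrow> 'v list \<Rightarrow> 'o \<Rightarrow> 'm \<Rightarrow> 'm" where
  "weaken \<Sigma> C M v w b g = Act C (index_fun v w) (ctx_obj \<Sigma> M v) b g"

definition admissible ::
  "('v list \<Rightarrow> 'v list \<Rightarrow> bool) \<Rightarrow> 'v list \<Rightarrow> ('f, 'v) trm list \<Rightarrow> 'v list list \<Rightarrow> bool" where
  "admissible R v ts ws \<longleftrightarrow> list_all2 (\<lambda>w t. R w (tau t)) ws ts \<and> R v (concat ws)"

text \<open>
  The value of an application does not depend on the choice of the contexts \<open>ws\<close>; see
  \<open>interp_Fun\<close> below.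
\<close>

function interp ::
  "('s, 'f, 'v) signature \<Rightarrow> ('v list \<Rightarrow> 'v list \<Rightarrow> bool) \<Rightarrow> ('o, 'm) multicat \<Rightarrow>
   ('s, 'f, 'o, 'm) model \<Rightarrow> 'v list \<Rightarrow> ('f, 'v) trm \<Rightarrow> 'm" where
  "interp \<Sigma> R C M v (Var x) =
     (let b = obj M (vtype \<Sigma> x) in weaken \<Sigma> C M v [x] b (Ident C b))"
| "interp \<Sigma> R C M v (Fun f []) =
     weaken \<Sigma> C M v [] (obj M (snd (ftype \<Sigma> f))) (mor M f)"
| "interp \<Sigma> R C M v (Fun f (t # ts)) =
     (let ws = (SOME ws. admissible R v (t # ts) ws);
          as = map (obj M) (fst (ftype \<Sigma> f));
          b = obj M (snd (ftype \<Sigma> f))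
      in weaken \<Sigma> C M v (concat ws) b
           (Comp C (map (ctx_obj \<Sigma> M) ws) as b (mor M f)
             (map (\<lambda>(w, u). interp \<Sigma> R C M w u) (zip ws (t # ts)))))"
  by pat_completeness auto
termination
proof (relation "measure (\<lambda>(_, _, _, _, _, t). size t)", goal_cases)
  case (2 \<Sigma> R C M v f t ts ws as b p w u)
  then have "u \<in> set (t # ts)" by (metis set_zip_rightD)
  then have "size u \<le> size_list size (t # ts)" by (rule size_list_estimation') simp
  then show ?case by simp
qed simp

primrec satisfies ::
  "('s, 'f, 'v) signature \<Rightarrow> ('v list \<Rightarrow> 'v list \<Rightarrow> bool) \<Rightarrow> ('o, 'm) multicat \<Rightarrow>
   ('s, 'f, 'o, 'm) model \<Rightarrow> ('f, 'v) equation \<Rightarrow> bool" where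
  "satisfies \<Sigma> R C M (v \<turnstile> t\<^sub>1 \<approx> t\<^sub>2) \<longleftrightarrow> interp \<Sigma> R C M v t\<^sub>1 = interp \<Sigma> R C M v t\<^sub>2"

definition entails ::
  "('s, 'f, 'v) signature \<Rightarrow> ('v list \<Rightarrow> 'v list \<Rightarrow> bool) \<Rightarrow> ('o, 'm) multicat \<Rightarrow>
   ('f, 'v) equation set \<Rightarrow> ('f, 'v) equation \<Rightarrow> bool" where
  "entails \<Sigma> R C E \<phi> \<longleftrightarrow>
     (\<forall>M. is_model \<Sigma> C M \<longrightarrow> (\<forall>e\<in>E. satisfies \<Sigma> R C M e) \<longrightarrow> satisfies \<Sigma> R C M \<phi>)"


section \<open>Well-definedness of the interpretation\<close>

lemma reindex_inject:
  assumes "distinct v" "\<theta> \<in> finord k (length v)" "\<theta>' \<in> finord k (length v)"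
    and "reindex v \<theta> = reindex v \<theta>'"
  shows "\<theta> = \<theta>'"
proof (rule nth_equalityI)
  show "length \<theta> = length \<theta>'" using assms by (simp add: finord_def)
  fix i assume i: "i < length \<theta>"
  then have "v ! (\<theta> ! i) = v ! (\<theta>' ! i)"
    using arg_cong[OF assms(4), of "\<lambda>w. w ! i"] assms(2,3) by (simp add: finord_def reindex_def)
  moreover have "\<theta> ! i < length v" "\<theta>' ! i < length v"
    using assms(2,3) i
    by (auto simp: finord_def subset_iff)
  ultimately show "\<theta> ! i = \<theta>' ! i" using assms(1) nth_eq_iff_index_eq by blast
qed

lemma index_fun_eqI:
  assumes "distinct v" "\<theta> \<in> finord (length w) (length v)" "reindex v \<theta> = w"
  shows "index_fun v w = \<theta>"
  unfolding index_fun_def using assms by (intro the_equality) (auto intro: reindex_inject)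

lemma (in context_structure) index_fun:
  assumes "R v w"
  shows "index_fun v w \<in> Delta V R (length w) (length v)" "reindex v (index_fun v w) = w"
proof -
  have v: "is_context V v" using R_dom assms by blast
  have "\<forall>x\<in>set w. \<exists>j<length v. v ! j = x"
    using R_vars[OF assms] by (metis in_set_conv_nth subsetD)
  then obtain p where p: "\<forall>x\<in>set w. p x < length v \<and> v ! p x = x" by metis
  then have "map p w \<in> finord (length w) (length v)" "reindex v (map p w) = w"
    by (auto simp: finord_def reindex_def map_idI)
  moreover from this v have "index_fun v w = map p w"
    by (intro index_fun_eqI) (auto simp: is_context_def)
  ultimately show "index_fun v w \<in> Delta V R (length w) (length v)" "reindex v (index_fun v w) = w"
    using v assms by (auto simp: Delta_def)
qed

lemma reindex_ctx_obj:
  "set \<theta> \<subseteq> {..<length v} \<Longrightarrow> reindex (ctx_obj \<Sigma> M v) \<theta> = ctx_obj \<Sigma> M (reindex v \<theta>)"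
  by (auto simp: reindex_def ctx_obj_def)

lemma ctx_obj_concat: "ctx_obj \<Sigma> M (concat ws) = concat (map (ctx_obj \<Sigma> M) ws)"
  by (simp add: ctx_obj_def[abs_def] map_concat)

lemma length_ctx_obj [simp]: "length (ctx_obj \<Sigma> M v) = length v"
  by (simp add: ctx_obj_def)

primrec raw ::
  "('s, 'f, 'v) signature \<Rightarrow> ('o, 'm) multicat \<Rightarrow> ('s, 'f, 'o, 'm) model \<Rightarrow>
   ('f, 'v) trm \<Rightarrow> 'm" where
  "raw \<Sigma> C M (Var x) = Ident C (obj M (vtype \<Sigma> x))"
| "raw \<Sigma> C M (Fun f ts) =
     Comp C (map (\<lambda>t. ctx_obj \<Sigma> M (tau t)) ts) (map (obj M) (fst (ftype \<Sigma> f)))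
       (obj M (snd (ftype \<Sigma> f))) (mor M f) (map (raw \<Sigma> C M) ts)"

locale modelled = context_structure "Vars \<Sigma>" R + Delta_multicategory "Delta (Vars \<Sigma>) R" C
  for \<Sigma> :: "('s, 'f, 'v) signature" and R and C :: "('o, 'm) multicat" +
  fixes M :: "('s, 'f, 'o, 'm) model"
  assumes sig: "is_signature \<Sigma>" and mod: "modelable R" and model: "is_model \<Sigma> C M"
begin

lemma ctx_obj_in: "v \<in> lists (Vars \<Sigma>) \<Longrightarrow> ctx_obj \<Sigma> M v \<in> lists (Ob C)"
  using sig model by (auto simp: ctx_obj_def is_signature_def is_model_def)

lemma has_sort_in: "has_sort \<Sigma> t s \<Longrightarrow> s \<in> Sorts \<Sigma> \<and> tau t \<in> lists (Vars \<Sigma>)"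
proof (induction rule: has_sort.induct)
  case (2 f ss s ts)
  then show ?case
    using sig by (fastforce simp: is_signature_def list_all2_conv_all_nth in_set_conv_nth)
qed (use sig in \<open>auto simp: is_signature_def\<close>)

lemma Homs_raw:
  assumes "list_all2 (\<lambda>t s. has_sort \<Sigma> t s \<and>
      raw \<Sigma> C M t \<in> Hom C (ctx_obj \<Sigma> M (tau t)) (obj M s)) ts ss"
  shows "map (raw \<Sigma> C M) ts \<in> Homs C (map (\<lambda>t. ctx_obj \<Sigma> M (tau t)) ts) (map (obj M) ss)"
proof -
  have "ctx_obj \<Sigma> M (tau t) \<in> lists (Ob C)" if "t \<in> set ts" for t
    using that assms has_sort_in ctx_obj_in
    by (metis (no_types, lifting) in_set_conv_nth list_all2_conv_all_nth)
  moreover have "obj M s \<in> Ob C" if "s \<in> set ss" for s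
    using that assms has_sort_in model unfolding is_model_def
    by (metis (no_types, lifting) in_set_conv_nth list_all2_conv_all_nth)
  ultimately show ?thesis using assms
    by (simp add: Homs_def list_all2_conv_all_nth in_lists_conv_set)
qed

lemma raw_in_Hom: "has_sort \<Sigma> t s \<Longrightarrow> raw \<Sigma> C M t \<in> Hom C (ctx_obj \<Sigma> M (tau t)) (obj M s)"
proof (induction rule: has_sort.induct)
  case (1 x)
  then show ?case
    using sig model Ident_in_Hom by (auto simp: ctx_obj_def is_signature_def is_model_def)
next
  case (2 f ss s ts)
  have "mor M f \<in> Hom C (map (obj M) ss) (obj M s)" "obj M s \<in> Ob C"
    using 2 sig model by (force simp: is_model_def is_signature_def)+
  from Comp_in_Hom[OF this(2,1) Homs_raw[OF 2(3)]] 2(2)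
  show ?case by (simp add: ctx_obj_concat o_def)
qed

lemma weaken_Comp:
  assumes f: "f \<in> Syms \<Sigma>" "ftype \<Sigma> f = (ss, s)" and ts: "list_all2 (has_sort \<Sigma>) ts ss"
    and ws: "admissible R v ts ws"
  shows "weaken \<Sigma> C M v (concat ws) (obj M s)
      (Comp C (map (ctx_obj \<Sigma> M) ws) (map (obj M) ss) (obj M s) (mor M f)
        (map (\<lambda>i. weaken \<Sigma> C M (ws ! i) (tau (ts ! i)) (obj M (ss ! i)) (raw \<Sigma> C M (ts ! i)))
          [0..<length ts]))
    = weaken \<Sigma> C M v (tau (Fun f ts)) (obj M s) (raw \<Sigma> C M (Fun f ts))"
proof -
  have len: "length ws = length ts" "length ss = length ts"
    using ts ws by (auto simp: admissible_def list_all2_lengthD)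
  have R: "R (ws ! i) (tau (ts ! i))" if "i < length ts" for i
    using ws that by (auto simp: admissible_def list_all2_conv_all_nth)
  have Rv: "R v (concat ws)" using ws by (simp add: admissible_def)
  have g: "mor M f \<in> Hom C (map (obj M) ss) (obj M s)" and s: "obj M s \<in> Ob C"
    using f sig model by (force simp: is_model_def is_signature_def)+
  let ?W = "map (ctx_obj \<Sigma> M) ws"
  define \<sigma>s where "\<sigma>s = map (\<lambda>i. index_fun (ws ! i) (tau (ts ! i))) [0..<length ts]"
  define ks where "ks = map (\<lambda>t. length (tau t)) ts"
  have \<sigma>l: "length \<sigma>s = length ts" by (simp add: \<sigma>s_def)
  have \<sigma>: "\<sigma>s ! i \<in> Delta (Vars \<Sigma>) R (ks ! i) (length (ws ! i))"
      "reindex (ws ! i) (\<sigma>s ! i) = tau (ts ! i)" if "i < length ts" for i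
    using index_fun[OF R[OF that]] that by (auto simp: \<sigma>s_def ks_def)
  have \<sigma>': "set (\<sigma>s ! i) \<subseteq> {..<length (ws ! i)}" if "i < length ts" for i
    using \<sigma>(1)[OF that] by (auto simp: Delta_def finord_def)
  have m2: "map2 reindex ?W \<sigma>s = map (\<lambda>t. ctx_obj \<Sigma> M (tau t)) ts"
    using len \<sigma>l \<sigma>(2) \<sigma>' by (intro nth_equalityI) (auto simp: reindex_ctx_obj)
  have m2': "map2 reindex ws \<sigma>s = map tau ts"
    using len \<sigma>l \<sigma>(2) by (intro nth_equalityI) auto
  have hom: "map (raw \<Sigma> C M) ts \<in> Homs C (map2 reindex ?W \<sigma>s) (map (obj M) ss)"
    unfolding m2 using ts raw_in_Hom by (intro Homs_raw) (auto elim: list_all2_mono)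
  have Wo: "?W \<in> lists (lists (Ob C))"
  proof -
    have "ctx_obj \<Sigma> M w \<in> lists (Ob C)" if "w \<in> set ws" for w
      using that R R_dom len by (metis ctx_obj_in in_set_conv_nth is_context_def)
    then show ?thesis by (simp add: in_lists_conv_set)
  qed
  let ?X = "Comp C (map2 reindex ?W \<sigma>s) (map (obj M) ss) (obj M s) (mor M f) (map (raw \<Sigma> C M) ts)"
  let ?\<sigma> = "coprod \<sigma>s (map length ws)"
  have 1: "Comp C ?W (map (obj M) ss) (obj M s) (mor M f)
        (map (\<lambda>i. weaken \<Sigma> C M (ws ! i) (tau (ts ! i)) (obj M (ss ! i)) (raw \<Sigma> C M (ts ! i)))
          [0..<length ts])
      = Act C ?\<sigma> (concat ?W) (obj M s) ?X"
  proof -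
    have eq: "(map (\<lambda>i. weaken \<Sigma> C M (ws ! i) (tau (ts ! i)) (obj M (ss ! i)) (raw \<Sigma> C M (ts ! i)))
          [0..<length ts])
      = map (\<lambda>i. Act C (\<sigma>s ! i) (?W ! i) (map (obj M) ss ! i) (map (raw \<Sigma> C M) ts ! i))
          [0..<length (map (obj M) ss)]"
      using len by (auto simp: weaken_def \<sigma>s_def)
    show ?thesis
      unfolding eq using Comp_Act_args[OF s g Wo _ _ _ _ hom, of ks] len \<sigma>l \<sigma>(1)
      by (simp add: ks_def o_def)
  qed
  have cop: "?\<sigma> \<in> Delta (Vars \<Sigma>) R (sum_list ks) (length (concat ws))"
    using coprod_closed[of ks \<sigma>s "map length ws"] len \<sigma>l \<sigma>(1)
    by (simp add: ks_def length_concat)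
  have re: "reindex (concat ws) ?\<sigma> = concat (map tau ts)"
    using reindex_coprod[of \<sigma>s ws] \<sigma>l len \<sigma>' m2' by simp
  let ?\<tau> = "index_fun v (concat ws)"
  note \<tau> = index_fun[OF Rv]
  have v: "is_context (Vars \<Sigma>) v" using R_dom Rv by blast
  have X: "?X \<in> Hom C (concat (map2 reindex ?W \<sigma>s)) (obj M s)"
    using Comp_in_Hom[OF s g hom] .
  have inc: "set ?\<sigma> \<subseteq> {..<length ?\<tau>}" "set ?\<tau> \<subseteq> {..<length v}"
    using cop \<tau>(1) by (auto simp: Delta_def finord_def)
  have r1: "reindex v (reindex ?\<tau> ?\<sigma>) = concat (map tau ts)"
  proof -
    have "reindex v (reindex ?\<tau> ?\<sigma>) = reindex (reindex v ?\<tau>) ?\<sigma>"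
      using inc by (auto simp: reindex_def)
    then show ?thesis using \<tau>(2) re by simp
  qed
  have d: "reindex ?\<tau> ?\<sigma> \<in> Delta (Vars \<Sigma>) R (sum_list ks) (length v)"
    using comp_closed[OF cop \<tau>(1)] .
  have "reindex (ctx_obj \<Sigma> M v) (reindex ?\<tau> ?\<sigma>) = concat (map2 reindex ?W \<sigma>s)"
  proof -
    have "set (reindex ?\<tau> ?\<sigma>) \<subseteq> {..<length v}" using d by (auto simp: Delta_def finord_def)
    then show ?thesis by (simp add: reindex_ctx_obj r1 m2 ctx_obj_concat o_def)
  qed
  then have "Act C (reindex ?\<tau> ?\<sigma>) (ctx_obj \<Sigma> M v) (obj M s) ?X
      = Act C ?\<tau> (ctx_obj \<Sigma> M v) (obj M s) (Act C ?\<sigma> (reindex (ctx_obj \<Sigma> M v) ?\<tau>) (obj M s) ?X)"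
    using X s v by (intro Act_comp[OF cop \<tau>(1)]) (auto simp: is_context_def intro!: ctx_obj_in)
  moreover have "reindex (ctx_obj \<Sigma> M v) ?\<tau> = concat ?W"
    using inc \<tau>(2) by (simp add: reindex_ctx_obj ctx_obj_concat)
  moreover have "index_fun v (concat (map tau ts)) = reindex ?\<tau> ?\<sigma>"
    using v d r1 by (intro index_fun_eqI) (auto simp: is_context_def Delta_def finord_def ks_def length_concat o_def)
  ultimately show ?thesis using 1 f(2) m2 by (simp add: weaken_def)
qed

lemma interp_eq_raw:
  "has_sort \<Sigma> t s \<Longrightarrow> R v (tau t) \<Longrightarrow>
   interp \<Sigma> R C M v t = weaken \<Sigma> C M v (tau t) (obj M s) (raw \<Sigma> C M t)"
proof (induction t arbitrary: v s)
  case (Var x)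
  then show ?case by (auto simp: Let_def elim: has_sort.cases)
next
  case (Fun f ts)
  obtain ss where f: "f \<in> Syms \<Sigma>" "ftype \<Sigma> f = (ss, s)" "list_all2 (has_sort \<Sigma>) ts ss"
    using Fun.prems(1) by (auto elim: has_sort.cases)
  have g: "mor M f \<in> Hom C (map (obj M) ss) (obj M s)" "obj M s \<in> Ob C"
    using f sig model by (force simp: is_model_def is_signature_def)+
  show ?case
  proof (cases ts)
    case Nil
    then have "mor M f \<in> Hom C [] (obj M s)" "ss = []" using f g by auto
    then show ?thesis using Comp_Ident_right[of "[]"] g(2) f(2) Nil by simp
  next
    case (Cons u us)
    let ?ws = "SOME ws. admissible R v ts ws"
    have "R v (concat (map tau ts))" using Fun.prems by simp
    then obtain cs where "R v (concat cs)" "list_all2 R cs (map tau ts)"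
      using mod unfolding modelable_def by blast
    then have "\<exists>ws. admissible R v ts ws" by (auto simp: admissible_def list_all2_map2)
    then have ws: "admissible R v ts ?ws" by (rule someI_ex)
    then have l: "length ?ws = length ts" by (auto simp: admissible_def list_all2_lengthD)
    have "map (\<lambda>(w, u). interp \<Sigma> R C M w u) (zip ?ws ts) =
        map (\<lambda>i. weaken \<Sigma> C M (?ws ! i) (tau (ts ! i)) (obj M (ss ! i)) (raw \<Sigma> C M (ts ! i)))
          [0..<length ts]"
      using ws l f(3) Fun.IH
      by (intro nth_equalityI) (auto simp: admissible_def list_all2_conv_all_nth)
    then show ?thesis
      using weaken_Comp[OF f ws] f(2) Cons by (simp add: Let_def)
  qed
qed

theorem interp_Fun:
  assumes "has_sort \<Sigma> (Fun f ts) s" "admissible R v ts ws"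
  shows "interp \<Sigma> R C M v (Fun f ts) =
    weaken \<Sigma> C M v (concat ws) (obj M s)
      (Comp C (map (ctx_obj \<Sigma> M) ws) (map (obj M) (fst (ftype \<Sigma> f))) (obj M s) (mor M f)
        (map2 (interp \<Sigma> R C M) ws ts))"
proof -
  obtain ss where f: "f \<in> Syms \<Sigma>" "ftype \<Sigma> f = (ss, s)" "list_all2 (has_sort \<Sigma>) ts ss"
    using assms(1) by (auto elim: has_sort.cases)
  have l: "length ws = length ts" using assms(2) by (auto simp: admissible_def list_all2_lengthD)
  have "list_all2 R ws (map tau ts)" "R v (concat ws)"
    using assms(2) by (auto simp: admissible_def list_all2_map2)
  then have "R v (tau (Fun f ts))" using R_concat by simp
  moreover have "map2 (interp \<Sigma> R C M) ws ts =
      map (\<lambda>i. weaken \<Sigma> C M (ws ! i) (tau (ts ! i)) (obj M (ss ! i)) (raw \<Sigma> C M (ts ! i)))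
        [0..<length ts]"
    using assms(2) l f(3) interp_eq_raw
    by (intro nth_equalityI) (auto simp: admissible_def list_all2_conv_all_nth)
  ultimately show ?thesis
    using weaken_Comp[OF f assms(2)] interp_eq_raw[OF assms(1)] f(2) by simp
qed

end

end

theory Submission
  imports Defs
begin

text \<open>
  Interpreting a term in a context \<open>v\<close> amounts to weakening to \<open>v\<close> its interpretation \<open>raw\<close> in the
  word of its own variable occurrences, where no structure map is involved.  For \<open>raw\<close>, substitution
  is multicategorical composition, by associativity and the unit laws alone.  The compatibility of
  composition with the action of \<open>\<Delta>\<close> then moves all structure maps to the outside, where they
  collapse to a single one because a context has no repeated letters.  Hence the interpretation of
  \<open>s(t)\<close> depends only on the interpretations of \<open>t\<close> and of the terms \<open>s(v\<^sub>i)\<close>, which gives the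
  renaming rule.
\<close>

section \<open>Moving structure maps out of composites\<close>

lemma map_reindex: "set \<theta> \<subseteq> {..<length xs} \<Longrightarrow> reindex (map f xs) \<theta> = map f (reindex xs \<theta>)"
  by (auto simp: reindex_def)

text \<open>Both sides compose functions on positions. The range condition is there because
  \<open>!\<close> commutes with \<open>map\<close> only at valid positions.\<close>

lemma reindex_reindex:
  "set \<sigma> \<subseteq> {..<length \<tau>} \<Longrightarrow> reindex (reindex a \<tau>) \<sigma> = reindex a (reindex \<tau> \<sigma>)"
  by (auto simp: reindex_def)

context modelled
begin

lemma Delta_finord:
  assumes "\<theta> \<in> Delta (Vars \<Sigma>) R m n"
  shows "set \<theta> \<subseteq> {..<n}" "length \<theta> = m"
  using assms by (auto simp: Delta_def finord_def)

text \<open>Functoriality of the action merges the two structure maps into the one of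
  \<open>reindex ?\<tau> \<sigma>\<close>. This finds the letters of
  \<open>reindex u \<sigma>\<close> in \<open>v\<close>, and as \<open>v\<close> has no repeated
  letter, no other function does.\<close>

lemma weaken_Act:
  assumes vu: "R v u" and \<sigma>: "\<sigma> \<in> Delta (Vars \<Sigma>) R k (length u)" and b: "b \<in> Ob C"
    and f: "f \<in> Hom C (ctx_obj \<Sigma> M (reindex u \<sigma>)) b"
  shows "weaken \<Sigma> C M v u b (Act C \<sigma> (ctx_obj \<Sigma> M u) b f) = weaken \<Sigma> C M v (reindex u \<sigma>) b f"
proof -
  let ?\<tau> = "index_fun v u"
  note \<tau> = index_fun[OF vu]
  have v: "is_context (Vars \<Sigma>) v" using R_dom vu by blast
  have \<tau>\<sigma>: "reindex ?\<tau> \<sigma> \<in> Delta (Vars \<Sigma>) R k (length v)" using comp_closed[OF \<sigma> \<tau>(1)] .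
  have u: "reindex v (reindex ?\<tau> \<sigma>) = reindex u \<sigma>"
    using reindex_reindex[of \<sigma> ?\<tau> v] Delta_finord[OF \<sigma>] Delta_finord[OF \<tau>(1)] \<tau>(2) by simp
  have "index_fun v (reindex u \<sigma>) = reindex ?\<tau> \<sigma>"
    using v u \<tau>\<sigma> Delta_finord[OF \<sigma>]
    by (intro index_fun_eqI) (auto simp: is_context_def Delta_def reindex_def)
  moreover have "reindex (ctx_obj \<Sigma> M v) ?\<tau> = ctx_obj \<Sigma> M u"
    using \<tau> Delta_finord by (simp add: reindex_ctx_obj)
  moreover have "f \<in> Hom C (reindex (ctx_obj \<Sigma> M v) (reindex ?\<tau> \<sigma>)) b"
    using f u Delta_finord[OF \<tau>\<sigma>] by (simp add: reindex_ctx_obj)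
  ultimately show ?thesis
    using Act_comp[OF \<sigma> \<tau>(1) ctx_obj_in _ b, of v f] v
    by (simp add: weaken_def is_context_def)
qed

text \<open>Compatibility of composition with the action on arguments replaces the separate
  weakenings by their coproduct acting on the composite; \<open>weaken_Act\<close> absorbs it into
  the outer weakening. The \<open>us\<close> may repeat letters, since they will be the words
  \<open>tau (s x)\<close>.\<close>

lemma weaken_Comp_args:
  assumes v: "R v (concat ws)" and wu: "list_all2 R ws us"
    and c: "c \<in> Ob C" and g: "g \<in> Hom C bs c" and fs: "fs \<in> Homs C (map (ctx_obj \<Sigma> M) us) bs"
  shows "weaken \<Sigma> C M v (concat ws) c (Comp C (map (ctx_obj \<Sigma> M) ws) bs c g
        (map (\<lambda>i. weaken \<Sigma> C M (ws ! i) (us ! i) (bs ! i) (fs ! i)) [0..<length bs]))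
    = weaken \<Sigma> C M v (concat us) c (Comp C (map (ctx_obj \<Sigma> M) us) bs c g fs)"
proof -
  have len: "length us = length bs" "length ws = length bs"
    using fs wu by (auto simp: Homs_def list_all2_lengthD)
  define \<sigma>s where "\<sigma>s = map2 index_fun ws us"
  have \<sigma>l: "length \<sigma>s = length bs" using len by (simp add: \<sigma>s_def)
  have R: "R (ws ! i) (us ! i)" if "i < length bs" for i
    using wu that len by (simp add: list_all2_conv_all_nth)
  have \<sigma>: "\<sigma>s ! i \<in> Delta (Vars \<Sigma>) R (map length us ! i) (length (ws ! i))"
    "reindex (ws ! i) (\<sigma>s ! i) = us ! i" if "i < length bs" for i
    using index_fun[OF R[OF that]] that len by (auto simp: \<sigma>s_def)
  have \<sigma>': "set (\<sigma>s ! i) \<subseteq> {..<length (ws ! i)}" if "i < length bs" for i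
    using Delta_finord[OF \<sigma>(1)[OF that]] by simp
  have us: "map2 reindex ws \<sigma>s = us"
    using len \<sigma>l \<sigma>(2) by (intro nth_equalityI) auto
  have Us: "map2 reindex (map (ctx_obj \<Sigma> M) ws) \<sigma>s = map (ctx_obj \<Sigma> M) us"
    using len \<sigma>l \<sigma>(2) \<sigma>' by (intro nth_equalityI) (auto simp: reindex_ctx_obj)
  have "w \<in> lists (Vars \<Sigma>)" if "w \<in> set ws" for w
    using that R len R_dom by (metis in_set_conv_nth is_context_def)
  then have Wo: "map (ctx_obj \<Sigma> M) ws \<in> lists (lists (Ob C))"
    by (intro in_listsI) (auto intro!: ctx_obj_in simp del: in_lists_conv_set)
  let ?\<sigma> = "coprod \<sigma>s (map length ws)"
  have \<sigma>_in: "?\<sigma> \<in> Delta (Vars \<Sigma>) R (sum_list (map length us)) (length (concat ws))"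
    using coprod_closed[of "map length us" \<sigma>s "map length ws"] len \<sigma>l \<sigma>(1)
    by (simp add: length_concat)
  \<comment> \<open>Block by block, the coproduct picks \<open>us ! i\<close> out of
    \<open>ws ! i\<close>, so the merged weakening is the one to \<open>concat us\<close>.\<close>
  have re: "reindex (concat ws) ?\<sigma> = concat us"
    using reindex_coprod[of \<sigma>s ws] \<sigma>l len \<sigma>' us by simp
  have "Comp C (map (ctx_obj \<Sigma> M) ws) bs c g
        (map (\<lambda>i. weaken \<Sigma> C M (ws ! i) (us ! i) (bs ! i) (fs ! i)) [0..<length bs])
      = Comp C (map (ctx_obj \<Sigma> M) ws) bs c g
        (map (\<lambda>i. Act C (\<sigma>s ! i) (map (ctx_obj \<Sigma> M) ws ! i) (bs ! i) (fs ! i)) [0..<length bs])"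
    using len by (intro arg_cong[where f = "Comp C _ _ _ _"]) (auto simp: weaken_def \<sigma>s_def)
  also have "\<dots> = Act C ?\<sigma> (ctx_obj \<Sigma> M (concat ws)) c (Comp C (map (ctx_obj \<Sigma> M) us) bs c g fs)"
    using Comp_Act_args[OF c g Wo _ _ _ _, of \<sigma>s "map length us" fs] len \<sigma>l \<sigma>(1) fs
    by (simp add: Us ctx_obj_concat o_def)
  finally show ?thesis
    using weaken_Act[OF v \<sigma>_in c] Comp_in_Hom[OF c g fs] re by (simp add: ctx_obj_concat)
qed

text \<open>A structure map on the outer morphism becomes its similarity component, which drops,
  permutes and copies whole blocks \<open>h x\<close>. Indexing blocks and arguments by letters,
  through \<open>h\<close> and \<open>k\<close>, gives every occurrence of a letter in
  \<open>u\<close> the same block and argument.\<close>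

lemma weaken_Comp_fun:
  assumes d: "R d (concat (map h v))" and vu: "R v u" and c: "c \<in> Ob C"
    and g: "g \<in> Hom C (ctx_obj \<Sigma> M u) c"
    and fs: "map k v \<in> Homs C (map (\<lambda>x. ctx_obj \<Sigma> M (h x)) v) (ctx_obj \<Sigma> M v)"
  shows "weaken \<Sigma> C M d (concat (map h v)) c (Comp C (map (\<lambda>x. ctx_obj \<Sigma> M (h x)) v)
        (ctx_obj \<Sigma> M v) c (weaken \<Sigma> C M v u c g) (map k v))
    = weaken \<Sigma> C M d (concat (map h u)) c
        (Comp C (map (\<lambda>x. ctx_obj \<Sigma> M (h x)) u) (ctx_obj \<Sigma> M u) c g (map k u))"
proof -
  let ?\<tau> = "index_fun v u" and ?ks = "map (\<lambda>x. length (h x)) v"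
  note \<tau> = index_fun[OF vu]
  have inc: "set ?\<tau> \<subseteq> {..<length v}" using Delta_finord[OF \<tau>(1)] by simp
  \<comment> \<open>Any list \<open>map f v\<close> reindexes to \<open>map f u\<close>; this serves
    for objects, lengths and arguments alike.\<close>
  note re = map_reindex[OF inc, unfolded \<tau>(2)]
  have reo: "reindex (ctx_obj \<Sigma> M v) ?\<tau> = ctx_obj \<Sigma> M u"
    using inc \<tau>(2) by (simp add: reindex_ctx_obj)
  let ?\<theta> = "similarity ?\<tau> ?ks"
  have \<theta>: "?\<theta> \<in> Delta (Vars \<Sigma>) R (sum_list (reindex ?ks ?\<tau>)) (length (concat (map h v)))"
    using similarity_closed[OF \<tau>(1), of ?ks] by (simp add: length_concat o_def)
  have re\<theta>: "reindex (concat (map h v)) ?\<theta> = concat (map h u)"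
    using reindex_similarity[of ?\<tau> "map h v"] inc by (simp add: o_def re)
  let ?X = "Comp C (map (\<lambda>x. ctx_obj \<Sigma> M (h x)) u) (ctx_obj \<Sigma> M u) c g (map k u)"
  have "Comp C (map (\<lambda>x. ctx_obj \<Sigma> M (h x)) v) (ctx_obj \<Sigma> M v) c
      (weaken \<Sigma> C M v u c g) (map k v) = Act C ?\<theta> (ctx_obj \<Sigma> M (concat (map h v))) c ?X"
    using Comp_Act_fun[OF \<tau>(1) c _ fs, of g] g
    by (simp add: weaken_def re reo o_def ctx_obj_concat)
  moreover have "map k u \<in> Homs C (map (\<lambda>x. ctx_obj \<Sigma> M (h x)) u) (ctx_obj \<Sigma> M u)"
  proof -
    \<comment> \<open>Typing is extracted letter by letter, so that it transfers to
      \<open>u\<close>, whose letters all occur in \<open>v\<close>.\<close>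
    have "k x \<in> Hom C (ctx_obj \<Sigma> M (h x)) (obj M (vtype \<Sigma> x)) \<and>
        ctx_obj \<Sigma> M (h x) \<in> lists (Ob C)" if "x \<in> set v" for x
    proof
      show "k x \<in> Hom C (ctx_obj \<Sigma> M (h x)) (obj M (vtype \<Sigma> x))"
        using fs that by (auto simp: Homs_def ctx_obj_def in_set_conv_nth[of x])
      show "ctx_obj \<Sigma> M (h x) \<in> lists (Ob C)"
        using fs that by (auto simp: Homs_def lists_eq_set)
    qed
    then show ?thesis
      using R_vars[OF vu] R_dom[OF vu] ctx_obj_in[of u]
      by (auto simp: Homs_def ctx_obj_def lists_eq_set image_subset_iff subset_iff)
  qed
  then have "?X \<in> Hom C (ctx_obj \<Sigma> M (concat (map h u))) c"
    using Comp_in_Hom[OF c g] by (simp add: ctx_obj_concat o_def)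
  ultimately show ?thesis
    using weaken_Act[OF d \<theta> c] re\<theta> by simp
qed

section \<open>Substitution as composition\<close>

lemma Homs_raw_subst:
  assumes "u \<in> lists (Vars \<Sigma>)" "\<And>x. x \<in> set u \<Longrightarrow> has_sort \<Sigma> (s x) (vtype \<Sigma> x)"
  shows "map (\<lambda>x. raw \<Sigma> C M (s x)) u
    \<in> Homs C (map (\<lambda>x. ctx_obj \<Sigma> M (tau (s x))) u) (ctx_obj \<Sigma> M u)"
  using Homs_raw[of "map s u" "map (vtype \<Sigma>) u"] assms(2) raw_in_Hom
  by (simp add: list_all2_conv_all_nth ctx_obj_def o_def)

text \<open>A variable is the left unit law, a function symbol is associativity. No structure map
  enters because \<open>tau t\<close> lists every occurrence of a variable, with repetitions and in
  order.\<close>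

lemma raw_subst:
  assumes "has_sort \<Sigma> t a" "\<And>x. x \<in> set (tau t) \<Longrightarrow> has_sort \<Sigma> (s x) (vtype \<Sigma> x)"
  shows "raw \<Sigma> C M (subst s t) =
    Comp C (map (\<lambda>x. ctx_obj \<Sigma> M (tau (s x))) (tau t)) (ctx_obj \<Sigma> M (tau t)) (obj M a)
      (raw \<Sigma> C M t) (map (\<lambda>x. raw \<Sigma> C M (s x)) (tau t))"
  using assms
proof (induction rule: has_sort.induct)
  case (1 x)
  then have x: "has_sort \<Sigma> (s x) (vtype \<Sigma> x)" by simp
  then have "obj M (vtype \<Sigma> x) \<in> Ob C" "ctx_obj \<Sigma> M (tau (s x)) \<in> lists (Ob C)"
    using has_sort_in model ctx_obj_in by (auto simp: is_model_def)
  then show ?case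
    using Comp_Ident_left raw_in_Hom[OF x] by (simp add: ctx_obj_def[of _ _ "[x]"])
next
  case (2 f ss a ts)
  have ts: "list_all2 (has_sort \<Sigma>) ts ss" using 2(3) by (auto elim: list_all2_mono)
  then have len: "length ss = length ts" by (simp add: list_all2_lengthD)
  have f: "mor M f \<in> Hom C (map (obj M) ss) (obj M a)" "obj M a \<in> Ob C"
    using 2(1,2) sig model by (force simp: is_model_def is_signature_def)+
  let ?c = "\<lambda>x. ctx_obj \<Sigma> M (tau (s x))" and ?r = "\<lambda>x. raw \<Sigma> C M (s x)"
  have sub: "raw \<Sigma> C M (subst s (ts ! i)) = Comp C (map ?c (tau (ts ! i)))
      (ctx_obj \<Sigma> M (tau (ts ! i))) (obj M (ss ! i)) (raw \<Sigma> C M (ts ! i))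
      (map ?r (tau (ts ! i)))" if "i < length ts" for i
    using 2(3,4) that by (fastforce simp: list_all2_conv_all_nth)
  have homs: "map (raw \<Sigma> C M) ts
      \<in> Homs C (map (\<lambda>t. ctx_obj \<Sigma> M (tau t)) ts) (map (obj M) ss)"
    using ts raw_in_Hom by (intro Homs_raw) (auto elim: list_all2_mono)
  have "map ?r (tau (ts ! i)) \<in> Homs C (map ?c (tau (ts ! i))) (ctx_obj \<Sigma> M (tau (ts ! i)))"
    if "i < length ts" for i
  proof (rule Homs_raw_subst)
    show "tau (ts ! i) \<in> lists (Vars \<Sigma>)"
      using has_sort_in ts that by (metis list_all2_conv_all_nth)
    show "has_sort \<Sigma> (s x) (vtype \<Sigma> x)" if "x \<in> set (tau (ts ! i))" for x
      using 2(4)[of x] nth_mem[OF \<open>i < length ts\<close>] that by auto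
  qed
  \<comment> \<open>Associativity for three layers: the symbol \<open>f\<close>, its arguments
    \<open>ts\<close>, and the terms substituted for the variable occurrences in each
    argument.\<close>
  then have "Comp C (map concat (map (\<lambda>t. map ?c (tau t)) ts)) (map (obj M) ss) (obj M a) (mor M f)
      (map (\<lambda>i. Comp C (map (\<lambda>t. map ?c (tau t)) ts ! i) (map (\<lambda>t. ctx_obj \<Sigma> M (tau t)) ts ! i)
          (map (obj M) ss ! i) (map (raw \<Sigma> C M) ts ! i) (map (\<lambda>t. map ?r (tau t)) ts ! i))
        [0..<length (map (obj M) ss)])
    = Comp C (concat (map (\<lambda>t. map ?c (tau t)) ts)) (concat (map (\<lambda>t. ctx_obj \<Sigma> M (tau t)) ts))
      (obj M a) (Comp C (map (\<lambda>t. ctx_obj \<Sigma> M (tau t)) ts) (map (obj M) ss) (obj M a) (mor M f)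
        (map (raw \<Sigma> C M) ts)) (concat (map (\<lambda>t. map ?r (tau t)) ts))"
    using len by (intro Comp_assoc[OF f(2,1) homs]) auto
  moreover have "map (\<lambda>i. Comp C (map (\<lambda>t. map ?c (tau t)) ts ! i)
          (map (\<lambda>t. ctx_obj \<Sigma> M (tau t)) ts ! i)
          (map (obj M) ss ! i) (map (raw \<Sigma> C M) ts ! i) (map (\<lambda>t. map ?r (tau t)) ts ! i))
        [0..<length (map (obj M) ss)] = map (\<lambda>t. raw \<Sigma> C M (subst s t)) ts"
    using len sub by (intro nth_equalityI) auto
  moreover have "raw \<Sigma> C M (subst s (Fun f ts)) =
      Comp C (map concat (map (\<lambda>t. map ?c (tau t)) ts)) (map (obj M) ss) (obj M a) (mor M f)
        (map (\<lambda>t. raw \<Sigma> C M (subst s t)) ts)"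
    using 2(2) by (simp add: tau_subst ctx_obj_concat o_def)
  ultimately have "raw \<Sigma> C M (subst s (Fun f ts)) =
      Comp C (concat (map (\<lambda>t. map ?c (tau t)) ts)) (concat (map (\<lambda>t. ctx_obj \<Sigma> M (tau t)) ts))
        (obj M a) (Comp C (map (\<lambda>t. ctx_obj \<Sigma> M (tau t)) ts) (map (obj M) ss) (obj M a) (mor M f)
          (map (raw \<Sigma> C M) ts)) (concat (map (\<lambda>t. map ?r (tau t)) ts))"
    by metis
  then show ?case
    using 2(2) by (simp add: o_def map_concat ctx_obj_concat)
qed

text \<open>On the right, \<open>t\<close> and the terms \<open>s (v ! i)\<close> enter only through
  their interpretations, which is what the renaming rule requires.\<close>

theorem interp_subst:
  assumes t: "has_sort \<Sigma> t a" "R v (tau t)" and ren: "R_renaming \<Sigma> R v s w ws"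
  shows "interp \<Sigma> R C M w (subst s t) =
    weaken \<Sigma> C M w (concat ws) (obj M a)
      (Comp C (map (ctx_obj \<Sigma> M) ws) (ctx_obj \<Sigma> M v) (obj M a) (interp \<Sigma> R C M v t)
        (map (\<lambda>i. interp \<Sigma> R C M (ws ! i) (s (v ! i))) [0..<length v]))"
proof -
  let ?us = "map (\<lambda>x. tau (s x)) v"
  have s: "has_sort \<Sigma> (s x) (vtype \<Sigma> x)" if "x \<in> set v" for x
    using ren that by (simp add: R_renaming_def)
  have ws: "list_all2 R ws ?us" and w: "R w (concat ws)"
    using ren by (auto simp: R_renaming_def list_all2_conv_all_nth)
  have v: "v \<in> lists (Vars \<Sigma>)" using R_dom[OF t(2)] by (simp add: is_context_def)
  have a: "obj M a \<in> Ob C" using has_sort_in[OF t(1)] model by (simp add: is_model_def)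
  have st: "has_sort \<Sigma> (s x) (vtype \<Sigma> x)" if "x \<in> set (tau t)" for x
    using s that R_vars[OF t(2)] by blast
  have homs: "map (\<lambda>x. raw \<Sigma> C M (s x)) v
      \<in> Homs C (map (\<lambda>x. ctx_obj \<Sigma> M (tau (s x))) v) (ctx_obj \<Sigma> M v)"
    using Homs_raw_subst[OF v s] .
  have int_t: "interp \<Sigma> R C M v t = weaken \<Sigma> C M v (tau t) (obj M a) (raw \<Sigma> C M t)"
    using interp_eq_raw[OF t] .
  \<comment> \<open>The arguments are unweakened first, with the already weakened interpretation of
    \<open>t\<close> as the outer morphism; hence its typing is needed.\<close>
  have "interp \<Sigma> R C M v t \<in> Hom C (ctx_obj \<Sigma> M v) (obj M a)"
    unfolding int_t weaken_def using index_fun[OF t(2)] Delta_finord raw_in_Hom[OF t(1)] a v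
    by (intro Act_in_Hom) (auto simp: reindex_ctx_obj intro!: ctx_obj_in)
  from weaken_Comp_args[OF w ws a this, of "map (\<lambda>x. raw \<Sigma> C M (s x)) v"] homs
  have "weaken \<Sigma> C M w (concat ws) (obj M a)
      (Comp C (map (ctx_obj \<Sigma> M) ws) (ctx_obj \<Sigma> M v) (obj M a) (interp \<Sigma> R C M v t)
        (map (\<lambda>i. weaken \<Sigma> C M (ws ! i) (?us ! i) (ctx_obj \<Sigma> M v ! i)
          (map (\<lambda>x. raw \<Sigma> C M (s x)) v ! i)) [0..<length v]))
    = weaken \<Sigma> C M w (concat ?us) (obj M a)
      (Comp C (map (\<lambda>x. ctx_obj \<Sigma> M (tau (s x))) v) (ctx_obj \<Sigma> M v) (obj M a)
        (weaken \<Sigma> C M v (tau t) (obj M a) (raw \<Sigma> C M t)) (map (\<lambda>x. raw \<Sigma> C M (s x)) v))"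
    by (simp add: o_def int_t)
  \<comment> \<open>Next the weakening of \<open>t\<close> moves outside, with
    \<open>tau (s x)\<close> as blocks; the composite left inside is that of
    \<open>raw_subst\<close>.\<close>
  also have "\<dots> = weaken \<Sigma> C M w (tau (subst s t)) (obj M a) (raw \<Sigma> C M (subst s t))"
    using weaken_Comp_fun[OF R_concat[OF w ws] t(2) a raw_in_Hom[OF t(1)] homs]
    by (simp add: raw_subst[OF t(1) st] tau_subst)
  also have "\<dots> = interp \<Sigma> R C M w (subst s t)"
    using interp_eq_raw[OF has_sort_subst[OF t(1) st] R_renaming_tau[OF HOL.refl ren t(2)]] by simp
  moreover have "map (\<lambda>i. weaken \<Sigma> C M (ws ! i) (?us ! i) (ctx_obj \<Sigma> M v ! i)
      (map (\<lambda>x. raw \<Sigma> C M (s x)) v ! i)) [0..<length v]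
    = map (\<lambda>i. interp \<Sigma> R C M (ws ! i) (s (v ! i))) [0..<length v]"
    using ren s by (auto simp: R_renaming_def ctx_obj_def intro!: interp_eq_raw[symmetric])
  ultimately show ?thesis by simp
qed

section \<open>Soundness of the deduction rules\<close>

lemma satisfies_deduct:
  assumes E: "R_theory \<Sigma> R E" and sat: "\<And>e. e \<in> E \<Longrightarrow> satisfies \<Sigma> R C M e"
    and "\<phi> \<in> deduct \<Sigma> R E"
  shows "satisfies \<Sigma> R C M \<phi>"
  using assms(3)
proof (induction rule: deduct.induct)
  case (rename v t\<^sub>1 t\<^sub>2 s\<^sub>1 w ws s\<^sub>2)
  \<comment> \<open>Derivable equations are \<open>R\<close>-equations, so both terms share the sort
    \<open>a\<close> and the context \<open>v\<close>. The two instances of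
    \<open>interp_subst\<close> then differ only in parts that the induction hypotheses
    identify.\<close>
  obtain a where a: "has_sort \<Sigma> t\<^sub>1 a" "has_sort \<Sigma> t\<^sub>2 a" "R v (tau t\<^sub>1)" "R v (tau t\<^sub>2)"
    using deduct_R_equations[OF context_structure_axioms E rename(1)]
    by (auto simp: R_equations_def)
  have "map (\<lambda>i. interp \<Sigma> R C M (ws ! i) (s\<^sub>1 (v ! i))) [0..<length v]
      = map (\<lambda>i. interp \<Sigma> R C M (ws ! i) (s\<^sub>2 (v ! i))) [0..<length v]"
    using rename by simp
  then show ?case
    using interp_subst[OF a(1,3) rename(2)] interp_subst[OF a(2,4) rename(3)] rename.IH(1)
    by (simp only: satisfies.simps)
qed (auto intro: sat)

end

theorem theorem3p18:
  fixes \<Sigma> :: "('s, 'f, 'v) signature"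
    and R :: "'v list \<Rightarrow> 'v list \<Rightarrow> bool"
    and E :: "('f, 'v) equation set"
    and \<phi> :: "('f, 'v) equation"
    and C :: "('o, 'm) multicat"
  assumes "is_signature \<Sigma>"
    and "context_structure (Vars \<Sigma>) R"
    and "modelable R"
    and "R_theory \<Sigma> R (E \<union> {\<phi>})"
    and "\<phi> \<in> deduct \<Sigma> R E"
    and "Delta_multicategory (Delta (Vars \<Sigma>) R) C"
  shows "entails \<Sigma> R C E \<phi>"
  unfolding entails_def
proof (intro allI impI)
  fix M :: "('s, 'f, 'o, 'm) model"
  assume M: "is_model \<Sigma> C M" and sat: "\<forall>e\<in>E. satisfies \<Sigma> R C M e"
  interpret modelled \<Sigma> R C M
    using assms M by (intro modelled.intro modelled_axioms.intro)
  show "satisfies \<Sigma> R C M \<phi>"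
    using satisfies_deduct[of E \<phi>] assms(4,5) sat by (simp add: R_theory_def)
qed

end
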